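(* Let $h:\mathbb{R}^n\to\mathbb{R}\cup\{+\infty\}$ be a kernel function and let $S\subseteq\operatorname{int}\operatorname{dom}(h)$ be a nonempty, convex and open set. Let $\psi:\mathbb{R}^m\to\mathbb{R}$ be convex and Lipschitz continuous with constant $L_\psi>0$, and let the mapping $F:\mathbb{R}^n\to\mathbb{R}^m$ be $L_F$-Bregman Jacobian smooth relative to $h$ on $S$. Then the composite function $\varphi:=\psi\circ F$ is $\rho$-weakly convex relative to $h$ on $S$ with $\rho=L_\psi L_F$.
   Context: A kernel function is a proper, lower semicontinuous, convex function $h:\mathbb{R}^n\to\mathbb{R}\cup\{+\infty\}$ with $\operatorname{int}\operatorname{dom}(h)\neq\emptyset$ that is continuously differentiable on $\operatorname{int}\operatorname{dom}(h)$. Its Bregman distance is $D_h(x,y)=h(x)-h(y)-\langle\nabla h(y),x-y\rangle$ for $y\in\operatorname{int}\operatorname{dom}(h)$ (and $+\infty$ otherwise). A mapping $F:\mathbb{R}^n\to\mathbb{R}^m$, differentiable on $S$ with $m\times n$ Jacobian $JF$, is $L_F$-Bregman Jacobian smooth relative to $h$ on $S$, with $L_F>0$, if $\|F(x)-F(y)-JF(y)(x-y)\|\le L_FD_h(x,y)$ for all $x,y\in S$. A function $\varphi$ is $\rho$-weakly convex relative to $h$ on $S$ if $\varphi+\rho h$ is convex on $S$. *)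

theory Defs
  imports "HOL-Analysis.Analysis"
begin

definition edom :: "('a \<Rightarrow> ereal) \<Rightarrow> 'a set" where
  "edom h = {x. h x < \<infinity>}"

definition proper_fun :: "('a \<Rightarrow> ereal) \<Rightarrow> bool" where
  "proper_fun h \<longleftrightarrow> (\<forall>x. h x \<noteq> - \<infinity>) \<and> edom h \<noteq> {}"

definition lower_semicontinuous :: "('a::topological_space \<Rightarrow> ereal) \<Rightarrow> bool" where
  "lower_semicontinuous h \<longleftrightarrow> (\<forall>x. h x \<le> Liminf (at x) h)"

text \<open>The extended-valued counterpart of \<^const>\<open>convex_on\<close>. In \<^typ>\<open>ereal\<close> one has
  \<open>0 * \<infinity> = 0\<close>, so the cases \<open>u = 0\<close> and \<open>v = 0\<close> hold trivially. Only meant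
  for functions that never take the value \<open>-\<infinity>\<close>.\<close>

definition econvex_on :: "'a::real_vector set \<Rightarrow> ('a \<Rightarrow> ereal) \<Rightarrow> bool" where
  "econvex_on S f \<longleftrightarrow> convex S \<and>
    (\<forall>x\<in>S. \<forall>y\<in>S. \<forall>u\<ge>0. \<forall>v\<ge>0. u + v = 1 \<longrightarrow>
      f (u *\<^sub>R x + v *\<^sub>R y) \<le> ereal u * f x + ereal v * f y)"

text \<open>The gradient is taken of the real-valued function \<open>real_of_ereal \<circ> h\<close>. It is meaningful at
  points of \<open>interior (edom h)\<close>, near which a proper \<open>h\<close> is finite.\<close>

definition grad :: "('a::real_inner \<Rightarrow> ereal) \<Rightarrow> 'a \<Rightarrow> 'a" where
  "grad h x = (THE g. GDERIV (\<lambda>z. real_of_ereal (h z)) x :> g)"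

lemma grad_eqI:
  assumes "GDERIV (\<lambda>z. real_of_ereal (h z)) x :> g"
  shows "grad h x = g"
  unfolding grad_def
proof (rule the_equality)
  show "GDERIV (\<lambda>z. real_of_ereal (h z)) x :> g" by (rule assms)
next
  fix g' assume "GDERIV (\<lambda>z. real_of_ereal (h z)) x :> g'"
  with assms have "(\<lambda>v. v \<bullet> g') = (\<lambda>v. v \<bullet> g)"
    unfolding gderiv_def by (rule has_derivative_unique[rotated])
  then show "g' = g"
    by (metis vector_eq_ldot)
qed

definition kernel_function :: "(real^'n \<Rightarrow> ereal) \<Rightarrow> bool" where
  "kernel_function h \<longleftrightarrow>
    proper_fun h \<and> lower_semicontinuous h \<and> econvex_on UNIV h \<and>
    interior (edom h) \<noteq> {} \<and>
    (\<forall>x\<in>interior (edom h). GDERIV (\<lambda>z. real_of_ereal (h z)) x :> grad h x) \<and>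
    continuous_on (interior (edom h)) (grad h)"

definition bregman_dist :: "(real^'n \<Rightarrow> ereal) \<Rightarrow> real^'n \<Rightarrow> real^'n \<Rightarrow> ereal" where
  "bregman_dist h x y =
    (if y \<in> interior (edom h) then h x - h y - ereal (grad h y \<bullet> (x - y)) else \<infinity>)"

definition bregman_jacobian_smooth ::
    "real \<Rightarrow> (real^'n \<Rightarrow> ereal) \<Rightarrow> (real^'n) set \<Rightarrow> (real^'n \<Rightarrow> real^'m) \<Rightarrow> bool" where
  "bregman_jacobian_smooth L h S F \<longleftrightarrow>
    L > 0 \<and> (\<forall>x\<in>S. F differentiable (at x)) \<and>
    (\<forall>x\<in>S. \<forall>y\<in>S.
      ereal (norm (F x - F y - jacobian F (at y) *v (x - y))) \<le> ereal L * bregman_dist h x y)"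

definition weakly_convex_rel ::
    "real \<Rightarrow> (real^'n \<Rightarrow> ereal) \<Rightarrow> (real^'n) set \<Rightarrow> (real^'n \<Rightarrow> real) \<Rightarrow> bool" where
  "weakly_convex_rel \<rho> h S \<phi> \<longleftrightarrow> econvex_on S (\<lambda>x. ereal (\<phi> x) + ereal \<rho> * h x)"

end

theory Submission
  imports Defs
begin

text \<open>
  At \<open>z = u x + v y\<close> the Jacobian terms of \<open>u (F x - F z)\<close> and \<open>v (F y - F z)\<close> cancel, so
  \<open>F z\<close> differs from \<open>u F x + v F y\<close> only by the averaged linearisation errors. These cost at most
  \<open>L\<^sub>\<psi> L\<^sub>F (u D\<^sub>h(x,z) + v D\<^sub>h(y,z))\<close> under \<open>\<psi>\<close>, and the gradient terms of the Bregman distances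
  cancel as well, leaving \<open>L\<^sub>\<psi> L\<^sub>F (u h x + v h y - h z)\<close>.
\<close>

text \<open>The displacements of \<open>x\<close> and \<open>y\<close> from their convex combination
  \<open>z\<close> average to zero, and a linear map preserves this. A general \<open>f\<close>
  covers both the Jacobian and the inner product with the gradient.\<close>

lemma convex_combination_diff_cancel:
  fixes f :: "'a::real_vector \<Rightarrow> 'b::real_vector"
  assumes "linear f" and uv: "u + v = 1" and z: "z = u *\<^sub>R x + v *\<^sub>R y"
  shows "u *\<^sub>R f (x - z) + v *\<^sub>R f (y - z) = 0"
proof -
  interpret linear f by fact
  have "u *\<^sub>R (x - z) + v *\<^sub>R (y - z) = (u *\<^sub>R x + v *\<^sub>R y) - (u + v) *\<^sub>R z"
    by (simp add: algebra_simps)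
  also have "\<dots> = 0"
    using uv z by simp
  finally have "f (u *\<^sub>R (x - z) + v *\<^sub>R (y - z)) = 0"
    by (simp add: zero)
  then show ?thesis
    by (simp add: add scale)
qed

lemma proper_fun_finite:
  assumes "proper_fun h" and "x \<in> edom h"
  shows "h x = ereal (real_of_ereal (h x))"
proof -
  have "\<bar>h x\<bar> \<noteq> \<infinity>"
    using assms by (cases "h x") (auto simp: proper_fun_def edom_def)
  then show ?thesis
    by (simp add: ereal_real')
qed

text \<open>The Lipschitz bound moves from \<open>F z\<close> to the average of \<open>F x\<close>
  and \<open>F y\<close>, where convexity of \<open>\<psi>\<close> applies. The error bounds
  \<open>dx\<close> and \<open>dy\<close> stay abstract, so this part takes place in the reals
  without any Bregman distance.\<close>

lemma convex_lipschitz_composite_le: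
  fixes \<psi> :: "'b::real_normed_vector \<Rightarrow> real" and F :: "'a::real_vector \<Rightarrow> 'b"
  assumes conv: "convex_on UNIV \<psi>" and lip: "L-lipschitz_on UNIV \<psi>"
    and "linear J" and uv: "u \<ge> 0" "v \<ge> 0" "u + v = 1" and z: "z = u *\<^sub>R x + v *\<^sub>R y"
    and dx: "norm (F x - F z - J (x - z)) \<le> dx" and dy: "norm (F y - F z - J (y - z)) \<le> dy"
  shows "\<psi> (F z) \<le> u * \<psi> (F x) + v * \<psi> (F y) + L * (u * dx + v * dy)"
proof -
  let ?w = "u *\<^sub>R F x + v *\<^sub>R F y"
  have "u *\<^sub>R (F x - F z - J (x - z)) + v *\<^sub>R (F y - F z - J (y - z))
      = ?w - (u + v) *\<^sub>R F z - (u *\<^sub>R J (x - z) + v *\<^sub>R J (y - z))"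
    by (simp add: algebra_simps)
  also have "\<dots> = ?w - F z"
    using convex_combination_diff_cancel[OF \<open>linear J\<close> uv(3) z] uv(3) by simp
  finally have "norm (?w - F z)
      \<le> norm (u *\<^sub>R (F x - F z - J (x - z))) + norm (v *\<^sub>R (F y - F z - J (y - z)))"
    by (metis norm_triangle_ineq)
  also have "\<dots> \<le> u * dx + v * dy"
    using uv dx dy by (simp add: add_mono mult_left_mono)
  finally have *: "norm (?w - F z) \<le> u * dx + v * dy" .
  have "\<psi> (F z) - \<psi> ?w \<le> dist (\<psi> (F z)) (\<psi> ?w)"
    by (simp add: dist_real_def)
  also have "\<dots> \<le> L * norm (?w - F z)"
    using lipschitz_onD[OF lip, of "F z" ?w] by (simp add: dist_norm norm_minus_commute)
  also have "\<dots> \<le> L * (u * dx + v * dy)"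
    using * lipschitz_on_nonneg[OF lip] by (rule mult_left_mono)
  finally have "\<psi> (F z) \<le> \<psi> ?w + L * (u * dx + v * dy)"
    by simp
  moreover have "\<psi> ?w \<le> u * \<psi> (F x) + v * \<psi> (F y)"
    using conv uv by (simp add: convex_on_def)
  ultimately show ?thesis
    by linarith
qed

theorem proposition3p11:
  fixes h :: "real^'n \<Rightarrow> ereal"
    and S :: "(real^'n) set"
    and \<psi> :: "real^'m \<Rightarrow> real"
    and F :: "real^'n \<Rightarrow> real^'m"
    and L\<^sub>\<psi> L\<^sub>F :: real
  assumes "kernel_function h"
    and "S \<noteq> {}" and "convex S" and "open S" and "S \<subseteq> interior (edom h)"
    and "convex_on UNIV \<psi>"
    and "L\<^sub>\<psi> > 0" and "L\<^sub>\<psi>-lipschitz_on UNIV \<psi>"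
    and "bregman_jacobian_smooth L\<^sub>F h S F"
  shows "weakly_convex_rel (L\<^sub>\<psi> * L\<^sub>F) h S (\<psi> \<circ> F)"
proof -
  \<comment> \<open>\<open>S\<close> lies inside the domain, where \<open>h\<close> is finite;
    replacing \<open>h\<close> by \<open>r\<close> there allows real arithmetic.\<close>
  define r where "r x = real_of_ereal (h x)" for x
  have h: "h x = ereal (r x)" if "x \<in> S" for x
    using proper_fun_finite[of h x] assms(1,5) that interior_subset[of "edom h"]
    unfolding r_def kernel_function_def by blast
  have le: "\<psi> (F z) + L\<^sub>\<psi> * L\<^sub>F * r z
      \<le> u * (\<psi> (F x) + L\<^sub>\<psi> * L\<^sub>F * r x) + v * (\<psi> (F y) + L\<^sub>\<psi> * L\<^sub>F * r y)"
    if S: "x \<in> S" "y \<in> S" "z \<in> S" and uv: "u \<ge> 0" "v \<ge> 0" "u + v = 1"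
      and z: "z = u *\<^sub>R x + v *\<^sub>R y" for x y z u v
  proof -
    \<comment> \<open>The real value of the Bregman distance from base point \<open>z\<close>: since
      \<open>z\<close> is in the interior of the domain, the infinite branch of
      \<open>bregman_dist\<close> does not occur.\<close>
    define D where "D w = r w - r z - grad h z \<bullet> (w - z)" for w
    have "bregman_dist h w z = ereal (D w)" if "w \<in> S" for w
      using that S assms(5) by (auto simp: bregman_dist_def h D_def)
    then have error: "norm (F w - F z - jacobian F (at z) *v (w - z)) \<le> L\<^sub>F * D w" if "w \<in> S" for w
      using assms(9) that S by (fastforce simp: bregman_jacobian_smooth_def)
    \<comment> \<open>On the reals \<open>*\<^sub>R\<close> is multiplication; it is written this
      way to match the cancellation lemma.\<close>
    have "u *\<^sub>R (grad h z \<bullet> (x - z)) + v *\<^sub>R (grad h z \<bullet> (y - z)) = 0"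
      using uv z by (intro convex_combination_diff_cancel bounded_linear.linear bounded_linear_inner_right)
    then have "u * D x + v * D y = u * r x + v * r y - (u + v) * r z"
      by (simp add: D_def algebra_simps)
    then have D: "u * D x + v * D y = u * r x + v * r y - r z"
      using uv by simp
    have "\<psi> (F z) \<le> u * \<psi> (F x) + v * \<psi> (F y) + L\<^sub>\<psi> * (u * (L\<^sub>F * D x) + v * (L\<^sub>F * D y))"
      using assms(6,8) matrix_vector_mul_linear uv z error[OF S(1)] error[OF S(2)]
      by (rule convex_lipschitz_composite_le)
    also have "L\<^sub>\<psi> * (u * (L\<^sub>F * D x) + v * (L\<^sub>F * D y)) = L\<^sub>\<psi> * L\<^sub>F * (u * D x + v * D y)"
      by (simp add: algebra_simps)
    finally show ?thesis
      unfolding D by (simp add: algebra_simps)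
  qed
  show ?thesis
    unfolding weakly_convex_rel_def econvex_on_def
  proof (intro conjI ballI allI impI)
    fix x y and u v :: real
    assume S: "x \<in> S" "y \<in> S" and uv: "0 \<le> u" "0 \<le> v" "u + v = 1"
    have z: "u *\<^sub>R x + v *\<^sub>R y \<in> S"
      using \<open>convex S\<close> S uv by (rule convexD)
    show "ereal ((\<psi> \<circ> F) (u *\<^sub>R x + v *\<^sub>R y)) + ereal (L\<^sub>\<psi> * L\<^sub>F) * h (u *\<^sub>R x + v *\<^sub>R y)
      \<le> ereal u * (ereal ((\<psi> \<circ> F) x) + ereal (L\<^sub>\<psi> * L\<^sub>F) * h x)
        + ereal v * (ereal ((\<psi> \<circ> F) y) + ereal (L\<^sub>\<psi> * L\<^sub>F) * h y)"
      \<comment> \<open>All three values of \<open>h\<close> are finite, so the extended-real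
        inequality reduces to \<open>le\<close>.\<close>
      using le[OF S z uv refl] by (simp add: h S z)
  qed (fact \<open>convex S\<close>)
qed

end
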